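(* Let $(X,d,m)$ be a metric measure space with dual heat semigroup $(\hat P_t)_{t>0}$. For every (non-constant) geodesic $(\gamma^a)_{a\in[0,1]}$ in $X$ and every $p\in[1,\infty)$, $$\Theta_p^+(\gamma)\;\le\;\int_0^1 \vartheta^*(\gamma^a)\,da .$$
   Context: A metric measure space $(X,d,m)$ is a Polish space $X$ with complete separable metric $d$ inducing the topology and a Borel measure $m$ with full topological support such that $\int e^{-Cd^2(x,z)}\,dm(x)<\infty$ for some $C\in\mathbb R$, $z\in X$. $\mathcal P(X)$ is the set of Borel probability measures and $W$ the $L^2$-Kantorovich–Wasserstein distance. The Cheeger energy is $\mathcal E(u)=\frac12\int|Du|_*^2\,dm$ on $L^2(X,m)$ ($|Du|_*$ the minimal weak upper gradient); its $L^2$-gradient flow is the heat semigroup $P_t$. Standing assumption: $P_t$ extends to a semigroup of Markov kernels $\hat P_t:\mathcal P(X)\to\mathcal P(X)$ (dual heat semigroup) with $\hat P_t(u\,m)=(P_tu)\,m$ for nonnegative $u\in L^2(X,m)$ with $\int u\,dm=1$, and $\hat P_t\mu=\int\hat P_t\delta_x\,\mu(dx)$. For distinct $x,y\in X$, $$\vartheta^+(x,y)=-\liminf_{t\to0}\frac1t\log\Big(W(\hat P_t\delta_x,\hat P_t\delta_y)/d(x,y)\Big),\qquad \vartheta^*(x)=\limsup_{y,z\to x}\vartheta^+(y,z)$$ (limsup over pairs $y\neq z$). For a curve $(\mu^a)_{a\in[0,1]}$ in $(\mathcal P(X),W)$, the $p$-action is $\mathrm{Act}_p(\mu^\cdot)=\sup\sum_i|a_i-a_{i-1}|^{-(p-1)}W(\mu^{a_{i-1}},\mu^{a_i})^p$,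 supremum over all partitions $0=a_0<\dots<a_n=1$. For a curve $\gamma$ in $X$ put $\mu_t^a=\hat P_t\delta_{\gamma^a}$ for $t>0$, $\mu_0^a=\delta_{\gamma^a}$, and $$\Theta_p^+(\gamma)=-\frac1p\liminf_{t\to0}\frac1t\log\Big(\mathrm{Act}_p(\mu_t^\cdot)/\mathrm{Act}_p(\mu_0^\cdot)\Big).$$ A geodesic is a constant-speed minimizing geodesic parametrized by $[0,1]$.
   Formalization: The formal theorem also assumes ϑ*(γ^a) < ∞ for every a in [0,1]. Without it the claim fails: on [0,∞) with Lebesgue measure, Neumann heat flow and γ^a = a, the integral is 0 but Θ_p^+(γ) = +∞, as ϑ*(0) = +∞. *)

theory Defs
  imports "HOL-Probability.Probability"
begin

section \<open>Extended arithmetic\<close>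

text \<open>Real powers on \<open>[0,\<infinity>]\<close>; used only for positive exponents.\<close>

definition ennpow :: "ennreal \<Rightarrow> real \<Rightarrow> ennreal" where
  "ennpow x r = (if x = \<infinity> then \<infinity> else ennreal (enn2real x powr r))"

text \<open>The logarithm \<open>[0,\<infinity>] \<rightarrow> [-\<infinity>,\<infinity>]\<close>.\<close>

definition elog :: "ennreal \<Rightarrow> ereal" where
  "elog x = (if x = 0 then -\<infinity> else if x = \<infinity> then \<infinity> else ereal (ln (enn2real x)))"

text \<open>Lebesgue integral of an extended real function, as the integral of the positive part minus
  the integral of the negative part. (Note \<open>\<infinity> - \<infinity> = \<infinity>\<close> in \<open>ereal\<close>; the value is only meaningful if
  one of the two parts has finite integral.)\<close>

definition ereal_integral :: "'a measure \<Rightarrow> ('a \<Rightarrow> ereal) \<Rightarrow> ereal" where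
  "ereal_integral M f =
     enn2ereal (\<integral>\<^sup>+ x. e2ennreal (f x) \<partial>M) - enn2ereal (\<integral>\<^sup>+ x. e2ennreal (- f x) \<partial>M)"


section \<open>Metric measure spaces, Wasserstein distance, curves\<close>

text \<open>The Polish space with its complete separable metric is the type \<open>'a :: polish_space\<close> with
  \<^const>\<open>dist\<close>; the reference measure is a Borel measure on it.\<close>

definition metric_measure_space :: "'a::polish_space measure \<Rightarrow> bool" where
  "metric_measure_space m \<longleftrightarrow>
     sets m = sets borel \<and>
     (\<forall>U. open U \<and> U \<noteq> {} \<longrightarrow> emeasure m U > 0) \<and>
     (\<exists>C::real. \<exists>z. (\<integral>\<^sup>+ x. ennreal (exp (- C * (dist x z)\<^sup>2)) \<partial>m) < \<infinity>)"

abbreviation borel_probs :: "'a::topological_space measure set" where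
  "borel_probs \<equiv> space (prob_algebra borel)"

abbreviation dirac :: "'a::topological_space \<Rightarrow> 'a measure" where
  "dirac x \<equiv> return borel x"

definition couplings ::
    "'a::polish_space measure \<Rightarrow> 'a measure \<Rightarrow> ('a \<times> 'a) measure set" where
  "couplings \<mu> \<nu> = {q \<in> borel_probs. distr q borel fst = \<mu> \<and> distr q borel snd = \<nu>}"

text \<open>The \<open>L\<^sup>2\<close>-Kantorovich--Wasserstein distance; it may be infinite on measures without second
  moments.\<close>

definition W2 :: "'a::polish_space measure \<Rightarrow> 'a measure \<Rightarrow> ennreal" where
  "W2 \<mu> \<nu> =
     ennpow (INF q\<in>couplings \<mu> \<nu>. \<integral>\<^sup>+ (x, y). ennreal ((dist x y)\<^sup>2) \<partial>q) (1/2)"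

definition partition01 :: "nat \<Rightarrow> (nat \<Rightarrow> real) \<Rightarrow> bool" where
  "partition01 n a \<longleftrightarrow> a 0 = 0 \<and> a n = 1 \<and> (\<forall>i<n. a i < a (Suc i))"

definition action :: "real \<Rightarrow> (real \<Rightarrow> 'a::polish_space measure) \<Rightarrow> ennreal" where
  "action p \<mu> = (SUP (n, a)\<in>{(n, a). partition01 n a}.
     \<Sum>i<n. ennreal (\<bar>a (Suc i) - a i\<bar> powr (- (p - 1))) * ennpow (W2 (\<mu> (a i)) (\<mu> (a (Suc i)))) p)"

definition geodesic :: "(real \<Rightarrow> 'a::metric_space) \<Rightarrow> bool" where
  "geodesic \<gamma> \<longleftrightarrow>
     (\<forall>a\<in>{0..1}. \<forall>b\<in>{0..1}. dist (\<gamma> a) (\<gamma> b) = \<bar>a - b\<bar> * dist (\<gamma> 0) (\<gamma> 1))"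

text \<open>\<open>c\<close> is an \<open>AC\<^sup>k\<close> curve on \<open>[a,b]\<close> with respect to the distance \<open>d\<close>.\<close>

definition ac_curve :: "nat \<Rightarrow> ('c \<Rightarrow> 'c \<Rightarrow> real) \<Rightarrow> (real \<Rightarrow> 'c) \<Rightarrow> real \<Rightarrow> real \<Rightarrow> bool" where
  "ac_curve k d c a b \<longleftrightarrow>
     (\<exists>g::real \<Rightarrow> ennreal. g \<in> borel_measurable borel \<and>
        (\<integral>\<^sup>+ r\<in>{a..b}. g r ^ k \<partial>lborel) < \<infinity> \<and>
        (\<forall>s t. a \<le> s \<and> s \<le> t \<and> t \<le> b \<longrightarrow> ennreal (d (c s) (c t)) \<le> (\<integral>\<^sup>+ r\<in>{s..t}. g r \<partial>lborel)))"

text \<open>For absolutely continuous curves the limit exists, and hence equals the upper limit, at almost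
  every \<open>s\<close>.\<close>

definition metric_speed :: "(real \<Rightarrow> 'a::metric_space) \<Rightarrow> real \<Rightarrow> ennreal" where
  "metric_speed \<gamma> s =
     Limsup (at s within {0..1}) (\<lambda>r. ennreal (dist (\<gamma> r) (\<gamma> s) / \<bar>r - s\<bar>))"


section \<open>Weak upper gradients and the Cheeger energy\<close>

text \<open>Since the target is separable, the Borel \<open>\<sigma>\<close>-algebra of \<open>C([0,1],X)\<close> with the uniform distance
  is generated by the evaluation maps, i.e. it is the trace of the product \<open>\<sigma>\<close>-algebra. Curves are
  represented by functions which are \<^const>\<open>undefined\<close> outside \<open>[0,1]\<close>.\<close>

definition curve_space :: "(real \<Rightarrow> 'a::polish_space) measure" where
  "curve_space = restrict_space (PiM {0..1} (\<lambda>_. borel)) {\<gamma>. continuous_on {0..1} \<gamma>}"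

text \<open>Test plans: probability measures on curves with finite kinetic energy, concentrated on \<open>AC\<^sup>2\<close>
  curves, with bounded compression.\<close>

definition test_plan :: "'a::polish_space measure \<Rightarrow> (real \<Rightarrow> 'a) measure \<Rightarrow> bool" where
  "test_plan m \<pi> \<longleftrightarrow>
     \<pi> \<in> space (prob_algebra curve_space) \<and>
     (AE \<gamma> in \<pi>. ac_curve 2 dist \<gamma> 0 1) \<and>
     (\<integral>\<^sup>+ \<gamma>. (\<integral>\<^sup>+ s\<in>{0..1}. (metric_speed \<gamma> s)\<^sup>2 \<partial>lborel) \<partial>\<pi>) < \<infinity> \<and>
     (\<exists>C::real. \<forall>t\<in>{0..1}. \<forall>A\<in>sets borel.
        emeasure (distr \<pi> borel (\<lambda>\<gamma>. \<gamma> t)) A \<le> ennreal C * emeasure m A)"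

text \<open>\<open>L\<^sup>2(X,m)\<close> at the level of functions, that is, before identifying functions which agree almost
  everywhere.\<close>

definition L2_fun :: "'a measure \<Rightarrow> ('a \<Rightarrow> real) set" where
  "L2_fun m = {u \<in> borel_measurable m. integrable m (\<lambda>x. (u x)\<^sup>2)}"

definition L2_dist :: "'a measure \<Rightarrow> ('a \<Rightarrow> real) \<Rightarrow> ('a \<Rightarrow> real) \<Rightarrow> real" where
  "L2_dist m u v = sqrt (\<integral>x. (u x - v x)\<^sup>2 \<partial>m)"

text \<open>Square integrable weak upper gradients. For these, \<open>\<integral>\<^sub>\<gamma> G\<close> is automatically finite for almost
  every curve of every test plan.\<close>

definition weak_upper_gradient :: "'a::polish_space measure \<Rightarrow> ('a \<Rightarrow> real) \<Rightarrow> ('a \<Rightarrow> real) \<Rightarrow> bool" where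
  "weak_upper_gradient m u G \<longleftrightarrow>
     G \<in> L2_fun m \<and> (\<forall>x. 0 \<le> G x) \<and>
     (\<forall>\<pi>. test_plan m \<pi> \<longrightarrow>
        (AE \<gamma> in \<pi>. ennreal \<bar>u (\<gamma> 1) - u (\<gamma> 0)\<bar>
           \<le> (\<integral>\<^sup>+ s\<in>{0..1}. ennreal (G (\<gamma> s)) * metric_speed \<gamma> s \<partial>lborel)))"

definition minimal_weak_upper_gradient ::
    "'a::polish_space measure \<Rightarrow> ('a \<Rightarrow> real) \<Rightarrow> ('a \<Rightarrow> real) \<Rightarrow> bool" where
  "minimal_weak_upper_gradient m u G \<longleftrightarrow>
     weak_upper_gradient m u G \<and>
     (\<forall>G'. weak_upper_gradient m u G' \<longrightarrow> (AE x in m. G x \<le> G' x))"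

text \<open>The minimal weak upper gradient is unique up to almost everywhere equality, so the choice is
  immaterial.\<close>

definition cheeger :: "'a::polish_space measure \<Rightarrow> ('a \<Rightarrow> real) \<Rightarrow> ennreal" where
  "cheeger m u =
     (if \<exists>G. minimal_weak_upper_gradient m u G
      then ennreal (1/2) * (\<integral>\<^sup>+ x. ennreal (((SOME G. minimal_weak_upper_gradient m u G) x)\<^sup>2) \<partial>m)
      else \<infinity>)"


section \<open>Heat semigroup and dual heat semigroup\<close>

definition cheeger_subdifferential ::
    "'a::polish_space measure \<Rightarrow> ('a \<Rightarrow> real) \<Rightarrow> ('a \<Rightarrow> real) set" where
  "cheeger_subdifferential m u =
     {\<xi> \<in> L2_fun m. cheeger m u < \<infinity> \<and>
        (\<forall>v\<in>L2_fun m. enn2ereal (cheeger m u) + ereal (\<integral>x. \<xi> x * (v x - u x) \<partial>m)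
           \<le> enn2ereal (cheeger m v))}"

text \<open>\<open>w\<close> is the \<open>L\<^sup>2\<close>-gradient flow of the Cheeger energy starting in \<open>u\<close>: a curve in \<open>L\<^sup>2(X,m)\<close>,
  locally absolutely continuous on \<open>(0,\<infinity>)\<close> and continuous at \<open>0\<close>, with
  \<open>\<partial>\<^sub>t w\<^sub>t \<in> - \<partial>\<E>(w\<^sub>t)\<close> for almost every \<open>t\<close>.\<close>

definition cheeger_gradient_flow ::
    "'a::polish_space measure \<Rightarrow> ('a \<Rightarrow> real) \<Rightarrow> (real \<Rightarrow> 'a \<Rightarrow> real) \<Rightarrow> bool" where
  "cheeger_gradient_flow m u w \<longleftrightarrow>
     (\<forall>t\<ge>0. w t \<in> L2_fun m) \<and>
     (AE x in m. w 0 x = u x) \<and>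
     ((\<lambda>t. L2_dist m (w t) u) \<longlongrightarrow> 0) (at_right 0) \<and>
     (\<forall>a b. 0 < a \<and> a < b \<longrightarrow> ac_curve 1 (L2_dist m) w a b) \<and>
     (AE t in lborel. 0 < t \<longrightarrow>
        (\<exists>\<xi>\<in>L2_fun m.
           ((\<lambda>h. L2_dist m (\<lambda>x. (w (t + h) x - w t x) / h) \<xi>) \<longlongrightarrow> 0) (at 0) \<and>
           (\<lambda>x. - \<xi> x) \<in> cheeger_subdifferential m (w t)))"

text \<open>The gradient flow is unique up to almost everywhere equality at each time, so the choice is
  immaterial.\<close>

definition heat_semigroup :: "'a::polish_space measure \<Rightarrow> real \<Rightarrow> ('a \<Rightarrow> real) \<Rightarrow> 'a \<Rightarrow> real" where
  "heat_semigroup m t u = (SOME w. cheeger_gradient_flow m u w) t"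

definition dual_heat_semigroup ::
    "'a::polish_space measure \<Rightarrow> (real \<Rightarrow> 'a measure \<Rightarrow> 'a measure) \<Rightarrow> bool" where
  "dual_heat_semigroup m P \<longleftrightarrow>
     (\<forall>t>0. \<forall>\<mu>\<in>borel_probs. P t \<mu> \<in> borel_probs) \<and>
     (\<forall>s>0. \<forall>t>0. \<forall>\<mu>\<in>borel_probs. P (s + t) \<mu> = P s (P t \<mu>)) \<and>
     (\<forall>t>0. (\<lambda>x. P t (dirac x)) \<in> borel \<rightarrow>\<^sub>M prob_algebra borel) \<and>
     (\<forall>t>0. \<forall>\<mu>\<in>borel_probs. P t \<mu> = \<mu> \<bind> (\<lambda>x. P t (dirac x))) \<and>
     (\<forall>t>0. \<forall>u\<in>L2_fun m. (AE x in m. 0 \<le> u x) \<and> (\<integral>\<^sup>+ x. ennreal (u x) \<partial>m) = 1 \<longrightarrow>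
        P t (density m (\<lambda>x. ennreal (u x))) = density m (\<lambda>x. ennreal (heat_semigroup m t u x)))"


section \<open>The quantities \<open>\<vartheta>\<^sup>+\<close>, \<open>\<vartheta>\<^sup>*\<close>, \<open>\<Theta>\<^sup>+\<close>\<close>

definition theta_plus ::
    "(real \<Rightarrow> 'a measure \<Rightarrow> 'a measure) \<Rightarrow> 'a::polish_space \<Rightarrow> 'a \<Rightarrow> ereal" where
  "theta_plus P x y =
     - Liminf (at_right 0)
         (\<lambda>t. ereal (1 / t) * elog (W2 (P t (dirac x)) (P t (dirac y)) / ennreal (dist x y)))"

text \<open>The pairs \<open>(y,z)\<close> with \<open>y \<noteq> z\<close> may have \<open>y = x\<close> or \<open>z = x\<close>.\<close>

definition theta_star :: "(real \<Rightarrow> 'a measure \<Rightarrow> 'a measure) \<Rightarrow> 'a::polish_space \<Rightarrow> ereal" where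
  "theta_star P x =
     Limsup (at (x, x) within {(y, z). y \<noteq> z}) (\<lambda>(y, z). theta_plus P y z)"

definition heat_curve ::
    "(real \<Rightarrow> 'a measure \<Rightarrow> 'a measure) \<Rightarrow> (real \<Rightarrow> 'a::polish_space) \<Rightarrow> real \<Rightarrow> real \<Rightarrow> 'a measure" where
  "heat_curve P \<gamma> t a = (if t = 0 then dirac (\<gamma> a) else P t (dirac (\<gamma> a)))"

definition Theta_plus ::
    "real \<Rightarrow> (real \<Rightarrow> 'a measure \<Rightarrow> 'a measure) \<Rightarrow> (real \<Rightarrow> 'a::polish_space) \<Rightarrow> ereal" where
  "Theta_plus p P \<gamma> =
     - (ereal (1 / p) * Liminf (at_right 0)
         (\<lambda>t. ereal (1 / t) * elog (action p (heat_curve P \<gamma> t) / action p (heat_curve P \<gamma> 0))))"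

end

theory Submission
  imports Defs
begin

text \<open>
  Write \<open>D\<close> for the length of the geodesic. Fix a partition of \<open>[0,1]\<close> with mesh widths
  \<open>\<Delta>\<^sub>i\<close>. If \<open>k\<^sub>i\<close> is a real number strictly above \<open>\<vartheta>\<^sup>+\<close> of the \<open>i\<close>-th pair of
  partition points, then for all small \<open>t\<close> the heat flow leaves at least the fraction
  \<open>exp (- k\<^sub>i t)\<close> of the distance of that pair. Testing the action at time \<open>t\<close> with this one partition
  bounds it from below by \<open>D\<^sup>p \<Sum>\<^sub>i \<Delta>\<^sub>i exp (- p k\<^sub>i t)\<close>, and Jensen's inequality for \<open>exp\<close> bounds
  this by \<open>D\<^sup>p exp (- p t \<Sum>\<^sub>i \<Delta>\<^sub>i k\<^sub>i)\<close>. The action of the geodesic itself is at most \<open>D\<^sup>p\<close>, so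
  taking logarithms and dividing by \<open>t\<close> gives \<open>\<Theta>\<^sup>+ \<le> \<Sum>\<^sub>i \<Delta>\<^sub>i k\<^sub>i\<close>
  (lemma \<open>Theta_plus_le_Riemann_sum\<close>). Working with real upper bounds \<open>k\<^sub>i\<close> instead of
  \<open>\<vartheta>\<^sup>+\<close> itself avoids sums in which \<open>\<infinity>\<close> and \<open>-\<infinity>\<close> meet.

  It remains to refine the partition. Along uniform partitions, the values of \<open>\<vartheta>\<^sup>+\<close> on
  neighbouring points form step functions whose upper limit at \<open>a\<close> is at most
  \<open>\<vartheta>\<^sup>*(\<gamma>\<^sup>a)\<close>, by the definition of \<open>\<vartheta>\<^sup>*\<close> as an upper limit over pairs. Since
  \<open>\<vartheta>\<^sup>* < \<infinity>\<close> on the compact curve, \<open>\<vartheta>\<^sup>+\<close> is bounded above on all sufficiently close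
  pairs (lemma \<open>compact_locally_bounded_near_diagonal\<close>), and the reverse Fatou lemma applies once
  the step functions are cut off from below. Letting the cut-off level tend to \<open>-\<infinity>\<close> by monotone
  convergence (lemma \<open>le_ereal_integral_of_shifts\<close>) gives the integral of \<open>\<vartheta>\<^sup>*\<close>. Its
  integrand is measurable because \<open>\<vartheta>\<^sup>*\<close> is upper semicontinuous.
\<close>

section \<open>Actions of curves\<close>

lemma ennpow_ennreal: "0 \<le> c \<Longrightarrow> ennpow (ennreal c) r = ennreal (c powr r)"
  by (simp add: ennpow_def)

lemma ennpow_mono:
  assumes "x \<le> y" "0 \<le> r"
  shows "ennpow x r \<le> ennpow y r"
  using assms
  by (cases x; cases y) (auto simp: ennpow_def top_unique intro!: ennreal_leI powr_mono2)

text \<open>The Dirac mass at \<open>(x, y)\<close> is a coupling. The bound serves to estimate the action in the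
  denominator of \<open>\<Theta>\<^sup>+\<close> from above.\<close>

lemma W2_dirac_le: "W2 (dirac x) (dirac y) \<le> ennreal (dist (x :: 'a::polish_space) y)"
proof -
  let ?q = "dirac (x, y)"
  have [measurable]: "fst \<in> borel_measurable (borel :: ('a \<times> 'a) measure)"
      "snd \<in> borel_measurable (borel :: ('a \<times> 'a) measure)"
    by (auto intro!: borel_measurable_continuous_onI continuous_intros)
  have "distr ?q borel fst = dirac x" "distr ?q borel snd = dirac y"
    by (simp_all add: distr_return)
  then have q: "?q \<in> couplings (dirac x) (dirac y)"
    by (simp add: couplings_def space_prob_algebra prob_space_return)
  have [measurable]: "(\<lambda>z :: 'a \<times> 'a. dist (fst z) (snd z)) \<in> borel_measurable borel"
    by (intro borel_measurable_continuous_onI continuous_intros)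
  have "(\<lambda>(x, y). ennreal ((dist x y)\<^sup>2)) \<in> borel_measurable (borel :: ('a \<times> 'a) measure)"
    unfolding split_beta by measurable
  then have "(\<integral>\<^sup>+ (x, y). ennreal ((dist x y)\<^sup>2) \<partial>?q) = ennreal ((dist x y)\<^sup>2)"
    by (simp add: nn_integral_return)
  then have "(INF q\<in>couplings (dirac x) (dirac y). \<integral>\<^sup>+ (x, y). ennreal ((dist x y)\<^sup>2) \<partial>q)
      \<le> ennreal ((dist x y)\<^sup>2)"
    using q by (metis (no_types, lifting) INF_lower)
  then have "W2 (dirac x) (dirac y) \<le> ennpow (ennreal ((dist x y)\<^sup>2)) (1/2)"
    unfolding W2_def by (rule ennpow_mono) simp
  also have "\<dots> = ennreal (dist x y)"
    by (simp add: ennpow_ennreal powr_half_sqrt)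
  finally show ?thesis .
qed

lemma partition01_mono:
  assumes "partition01 n a" "i \<le> j" "j \<le> n"
  shows "a i \<le> a j"
  using assms(2,3)
proof (induction j rule: dec_induct)
  case (step j)
  then have "a j < a (Suc j)"
    using assms(1) by (simp add: partition01_def)
  with step show ?case by simp
qed simp

lemma partition01_mem: "partition01 n a \<Longrightarrow> i \<le> n \<Longrightarrow> a i \<in> {0..1}"
  using partition01_mono[of n a 0 i] partition01_mono[of n a i n] by (simp add: partition01_def)

lemma partition01_sum: "partition01 n a \<Longrightarrow> (\<Sum>i<n. a (Suc i) - a i) = 1"
  by (simp add: partition01_def sum_lessThan_telescope)

lemma geodesic_dist:
  "geodesic \<gamma> \<Longrightarrow> a \<in> {0..1} \<Longrightarrow> b \<in> {0..1} \<Longrightarrow> dist (\<gamma> a) (\<gamma> b) = \<bar>a - b\<bar> * dist (\<gamma> 0) (\<gamma> 1)"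
  unfolding geodesic_def by blast

lemma geodesic_partition_dist:
  assumes "geodesic \<gamma>" "partition01 n a" "i < n"
  shows "dist (\<gamma> (a i)) (\<gamma> (a (Suc i))) = (a (Suc i) - a i) * dist (\<gamma> 0) (\<gamma> 1)"
proof -
  have "\<bar>a i - a (Suc i)\<bar> = a (Suc i) - a i"
    using assms(2,3) by (simp add: partition01_def less_imp_le)
  then show ?thesis
    using geodesic_dist[OF assms(1), of "a i" "a (Suc i)"] partition01_mem[OF assms(2)] assms(3)
    by simp
qed

text \<open>Along a constant speed curve each partition interval of width \<open>\<Delta>\<close> contributes
  \<open>\<Delta>\<^bsup>-(p-1)\<^esup> (\<Delta> D)\<^sup>p = \<Delta> D\<^sup>p\<close>, and the widths add up to 1.\<close>

lemma action_dirac_geodesic_le: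
  fixes \<gamma> :: "real \<Rightarrow> 'a::polish_space"
  assumes "geodesic \<gamma>" "0 \<le> p"
  shows "action p (\<lambda>a. dirac (\<gamma> a)) \<le> ennreal (dist (\<gamma> 0) (\<gamma> 1) powr p)"
proof -
  let ?D = "dist (\<gamma> 0) (\<gamma> 1)"
  have "(\<Sum>i<n. ennreal (\<bar>a (Suc i) - a i\<bar> powr (- (p - 1)))
          * ennpow (W2 (dirac (\<gamma> (a i))) (dirac (\<gamma> (a (Suc i))))) p) \<le> ennreal (?D powr p)"
    if a: "partition01 n a" for n a
  proof -
    have "ennreal (\<bar>a (Suc i) - a i\<bar> powr (- (p - 1)))
          * ennpow (W2 (dirac (\<gamma> (a i))) (dirac (\<gamma> (a (Suc i))))) p
          \<le> ennreal ((a (Suc i) - a i) * ?D powr p)" if i: "i < n" for i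
    proof -
      have pos: "a (Suc i) - a i > 0"
        using a i by (simp add: partition01_def)
      note d = geodesic_partition_dist[OF assms(1) a i]
      have "ennpow (W2 (dirac (\<gamma> (a i))) (dirac (\<gamma> (a (Suc i))))) p
          \<le> ennpow (ennreal ((a (Suc i) - a i) * ?D)) p"
        using W2_dirac_le[of "\<gamma> (a i)" "\<gamma> (a (Suc i))"] unfolding d
        by (rule ennpow_mono) (use assms in simp)
      also have "\<dots> = ennreal ((a (Suc i) - a i) powr p * ?D powr p)"
        using pos by (simp add: ennpow_ennreal powr_mult)
      finally have "ennreal (\<bar>a (Suc i) - a i\<bar> powr (- (p - 1)))
          * ennpow (W2 (dirac (\<gamma> (a i))) (dirac (\<gamma> (a (Suc i))))) p
          \<le> ennreal (\<bar>a (Suc i) - a i\<bar> powr (- (p - 1)))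
            * ennreal ((a (Suc i) - a i) powr p * ?D powr p)"
        by (rule mult_left_mono) simp
      also have "\<dots> = ennreal ((a (Suc i) - a i) * ?D powr p)"
        using pos by (simp add: ennreal_mult[symmetric] mult.assoc[symmetric] powr_add[symmetric])
      finally show ?thesis .
    qed
    then have "(\<Sum>i<n. ennreal (\<bar>a (Suc i) - a i\<bar> powr (- (p - 1)))
          * ennpow (W2 (dirac (\<gamma> (a i))) (dirac (\<gamma> (a (Suc i))))) p)
        \<le> (\<Sum>i<n. ennreal ((a (Suc i) - a i) * ?D powr p))"
      by (intro sum_mono) simp
    also have "\<dots> = ennreal (\<Sum>i<n. (a (Suc i) - a i) * ?D powr p)"
      using a by (intro sum_ennreal) (simp add: partition01_def less_imp_le)
    also have "\<dots> = ennreal (?D powr p)"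
      using partition01_sum[OF a] by (simp add: sum_distrib_right[symmetric])
    finally show ?thesis .
  qed
  then show ?thesis
    unfolding action_def by (auto intro!: SUP_least)
qed

text \<open>One partition already bounds the supremum from below. The weights \<open>\<Delta>\<^sub>i\<close> that survive the
  cancellation of powers form a convex combination, so Jensen's inequality for \<open>exp\<close> moves the
  average of the rates into the exponent.\<close>

lemma action_ge_of_contraction_rates:
  fixes \<mu> :: "real \<Rightarrow> 'a::polish_space measure"
  assumes a: "partition01 n a" and "0 \<le> p" "0 < D"
    and W: "\<And>i. i < n \<Longrightarrow>
      ennreal (exp (- k i * t) * ((a (Suc i) - a i) * D)) \<le> W2 (\<mu> (a i)) (\<mu> (a (Suc i)))"
  shows "ennreal (exp (- p * t * (\<Sum>i<n. (a (Suc i) - a i) * k i)) * D powr p) \<le> action p \<mu>"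
proof -
  let ?d = "\<lambda>i. a (Suc i) - a i"
  have pos: "?d i > 0" if "i < n" for i
    using a that by (simp add: partition01_def)
  have "n \<noteq> 0"
    using a by (cases n) (auto simp: partition01_def)
  then have "exp (\<Sum>i\<in>{..<n}. ?d i *\<^sub>R (- p * t * k i))
      \<le> (\<Sum>i\<in>{..<n}. ?d i * exp (- p * t * k i))"
    using pos partition01_sum[OF a]
    by (intro convex_on_sum[OF _ _ exp_convex]) (auto simp: less_imp_le)
  moreover have "(\<Sum>i\<in>{..<n}. ?d i *\<^sub>R (- p * t * k i)) = - p * t * (\<Sum>i<n. ?d i * k i)"
    by (simp add: sum_distrib_left sum_negf algebra_simps)
  ultimately have "ennreal (exp (- p * t * (\<Sum>i<n. ?d i * k i)) * D powr p)
      \<le> ennreal ((\<Sum>i<n. ?d i * exp (- p * t * k i)) * D powr p)"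
    by (intro ennreal_leI mult_right_mono) simp_all
  also have "\<dots> = (\<Sum>i<n. ennreal (?d i * exp (- p * t * k i) * D powr p))"
    unfolding sum_distrib_right using pos by (intro sum_ennreal[symmetric]) (simp add: less_imp_le)
  also have "\<dots> \<le> (\<Sum>i<n. ennreal (\<bar>?d i\<bar> powr (- (p - 1)))
      * ennpow (W2 (\<mu> (a i)) (\<mu> (a (Suc i)))) p)"
  proof (rule sum_mono)
    fix i assume "i \<in> {..<n}"
    then have i: "i < n" by simp
    have "?d i * exp (- p * t * k i) * D powr p
        = \<bar>?d i\<bar> powr (- (p - 1)) * (exp (- k i * t) * (?d i * D)) powr p"
    proof -
      have "exp (- k i * t) powr p = exp (- p * t * k i)"
        by (simp add: powr_def algebra_simps)
      moreover have "?d i powr (- (p - 1)) * ?d i powr p = ?d i"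
        using pos[OF i] by (simp add: powr_add[symmetric])
      ultimately show ?thesis
        using pos[OF i] \<open>0 < D\<close> by (simp add: powr_mult)
    qed
    then have "ennreal (?d i * exp (- p * t * k i) * D powr p)
        = ennreal (\<bar>?d i\<bar> powr (- (p - 1))) * ennpow (ennreal (exp (- k i * t) * (?d i * D))) p"
      using pos[OF i] \<open>0 < D\<close> by (subst ennpow_ennreal) (simp_all flip: ennreal_mult)
    also have "\<dots> \<le> ennreal (\<bar>?d i\<bar> powr (- (p - 1)))
        * ennpow (W2 (\<mu> (a i)) (\<mu> (a (Suc i)))) p"
      by (intro mult_left_mono ennpow_mono W[OF i] \<open>0 \<le> p\<close>) simp
    finally show "ennreal (?d i * exp (- p * t * k i) * D powr p)
        \<le> ennreal (\<bar>?d i\<bar> powr (- (p - 1))) * ennpow (W2 (\<mu> (a i)) (\<mu> (a (Suc i)))) p" .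
  qed
  also have "\<dots> \<le> action p \<mu>"
    unfolding action_def using a by (intro SUP_upper2[of "(n, a)"]) auto
  finally show ?thesis .
qed

section \<open>\<open>\<Theta>\<^sup>+\<close> is bounded by Riemann sums of \<open>\<vartheta>\<^sup>+\<close>\<close>

lemma ereal_le_elog_iff: "ereal c \<le> elog x \<longleftrightarrow> ennreal (exp c) \<le> x"
proof (cases x)
  case (real r)
  show ?thesis
  proof (cases "r = 0")
    case True
    then show ?thesis using real by (simp add: elog_def ennreal_eq_0_iff)
  next
    case False
    then show ?thesis using real by (simp add: elog_def ln_ge_iff)
  qed
qed (simp add: elog_def)

lemma theta_plus_lessD:
  assumes "theta_plus P x y < ereal k" "x \<noteq> y"
  shows "eventually (\<lambda>t. ennreal (exp (- k * t) * dist x y) \<le> W2 (P t (dirac x)) (P t (dirac y)))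
    (at_right 0)"
proof -
  let ?r = "\<lambda>t. W2 (P t (dirac x)) (P t (dirac y)) / ennreal (dist x y)"
  have "ereal (- k) < Liminf (at_right 0) (\<lambda>t. ereal (1 / t) * elog (?r t))"
    using assms(1) unfolding theta_plus_def by (simp add: ereal_uminus_less_reorder)
  then have "eventually (\<lambda>t. ereal (- k) < ereal (1 / t) * elog (?r t)) (at_right 0)"
    by (rule less_LiminfD)
  moreover have "eventually (\<lambda>t::real. t > 0) (at_right 0)"
    by (simp add: eventually_at_right_less)
  ultimately show ?thesis
  proof eventually_elim
    case (elim t)
    have "ereal (- k * t) \<le> elog (?r t)"
      using elim by (cases "elog (?r t)") (auto simp: field_simps)
    then have "ennreal (exp (- k * t)) \<le> ?r t"
      by (simp only: ereal_le_elog_iff)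
    then have "ennreal (exp (- k * t)) * ennreal (dist x y) \<le> ?r t * ennreal (dist x y)"
      by (rule mult_right_mono) simp
    also have "\<dots> = W2 (P t (dirac x)) (P t (dirac y))"
      using assms(2) by (simp add: ennreal_divide_times ennreal_divide_self)
    finally show ?case by (simp add: ennreal_mult)
  qed
qed

text \<open>Finitely many pairs of partition points share a time interval \<open>(0, t\<^sub>0)\<close> on which all their
  contraction rates \<open>k\<^sub>i\<close> are valid, so the lower bound on the action holds for all small times and
  passes to the lower limit.\<close>

lemma Theta_plus_le_Riemann_sum:
  fixes \<gamma> :: "real \<Rightarrow> 'a::polish_space"
  assumes geo: "geodesic \<gamma>" "\<gamma> 0 \<noteq> \<gamma> 1" and p: "0 < p"
    and a: "partition01 n a"
    and k: "\<And>i. i < n \<Longrightarrow> theta_plus P (\<gamma> (a i)) (\<gamma> (a (Suc i))) < ereal (k i)"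
  shows "Theta_plus p P \<gamma> \<le> ereal (\<Sum>i<n. (a (Suc i) - a i) * k i)"
proof -
  let ?D = "dist (\<gamma> 0) (\<gamma> 1)" and ?K = "\<Sum>i<n. (a (Suc i) - a i) * k i"
  let ?act = "\<lambda>t. action p (heat_curve P \<gamma> t)"
  have D: "?D > 0"
    using geo by simp
  have d: "dist (\<gamma> (a i)) (\<gamma> (a (Suc i))) = (a (Suc i) - a i) * ?D" "a (Suc i) > a i" if "i < n" for i
    using geodesic_partition_dist[OF geo(1) a that] a that by (simp_all add: partition01_def)
  have "eventually (\<lambda>t. \<forall>i\<in>{..<n}. ennreal (exp (- k i * t) * dist (\<gamma> (a i)) (\<gamma> (a (Suc i))))
      \<le> W2 (P t (dirac (\<gamma> (a i)))) (P t (dirac (\<gamma> (a (Suc i)))))) (at_right 0)"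
  proof (intro eventually_ball_finite ballI finite_lessThan)
    fix i assume "i \<in> {..<n}"
    then have "\<gamma> (a i) \<noteq> \<gamma> (a (Suc i))"
      using d[of i] D by auto
    with k \<open>i \<in> {..<n}\<close>
    show "eventually (\<lambda>t. ennreal (exp (- k i * t) * dist (\<gamma> (a i)) (\<gamma> (a (Suc i))))
      \<le> W2 (P t (dirac (\<gamma> (a i)))) (P t (dirac (\<gamma> (a (Suc i)))))) (at_right 0)"
      by (intro theta_plus_lessD) auto
  qed
  moreover have "eventually (\<lambda>t::real. t > 0) (at_right 0)"
    by (simp add: eventually_at_right_less)
  ultimately have "eventually (\<lambda>t. ereal (- p * ?K) \<le> ereal (1 / t) * elog (?act t / ?act 0))
      (at_right 0)"
  proof eventually_elim
    case (elim t)
    have "ennreal (exp (- p * t * ?K)) * ennreal (?D powr p) \<le> ?act t"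
      unfolding ennreal_mult[OF less_imp_le[OF exp_gt_zero] powr_ge_zero, symmetric]
    proof (rule action_ge_of_contraction_rates[OF a less_imp_le[OF p] D])
      fix i assume i: "i < n"
      with elim have "ennreal (exp (- k i * t) * dist (\<gamma> (a i)) (\<gamma> (a (Suc i))))
          \<le> W2 (P t (dirac (\<gamma> (a i)))) (P t (dirac (\<gamma> (a (Suc i)))))"
        by simp
      then show "ennreal (exp (- k i * t) * ((a (Suc i) - a i) * ?D))
        \<le> W2 (heat_curve P \<gamma> t (a i)) (heat_curve P \<gamma> t (a (Suc i)))"
        using elim(2) by (simp add: heat_curve_def d(1)[OF i])
    qed
    moreover have act0: "?act 0 \<le> ennreal (?D powr p)"
      using action_dirac_geodesic_le[OF geo(1), of p] p by (simp add: heat_curve_def[abs_def])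
    ultimately have le: "ennreal (exp (- p * t * ?K)) * ?act 0 \<le> ?act t"
      by (meson mult_left_mono order_trans zero_le)
    have "ennreal (exp (- p * t * ?K)) \<le> ?act t / ?act 0"
      \<comment> \<open>Only an upper bound on the denominator is known. If it vanishes, the quotient of a positive
        action by it is infinite.\<close>
    proof (cases "?act 0 = 0")
      case True
      have "0 < ennreal (exp (- p * t * ?K)) * ennreal (?D powr p)"
        using D by (simp add: ennreal_zero_less_mult_iff)
      then have "?act t \<noteq> 0"
        using \<open>_ * ennreal (?D powr p) \<le> ?act t\<close> by (metis not_less)
      then show ?thesis
        using True by simp
    next
      case False
      have "?act 0 < top"
        using act0 by (rule order_le_less_trans) simp
      then have "ennreal (exp (- p * t * ?K)) = ennreal (exp (- p * t * ?K)) * ?act 0 / ?act 0"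
        using False by (simp add: mult_divide_eq_ennreal)
      also have "\<dots> \<le> ?act t / ?act 0"
        using le by (rule divide_right_mono_ennreal)
      finally show ?thesis .
    qed
    then have "ereal (- p * t * ?K) \<le> elog (?act t / ?act 0)"
      by (simp only: ereal_le_elog_iff)
    then have "ereal (1 / t) * ereal (- p * t * ?K) \<le> ereal (1 / t) * elog (?act t / ?act 0)"
      using elim by (intro ereal_mult_left_mono) auto
    then show ?case
      using elim by simp
  qed
  then have "ereal (- p * ?K) \<le> Liminf (at_right 0) (\<lambda>t. ereal (1 / t) * elog (?act t / ?act 0))"
    by (rule Liminf_bounded)
  then have "ereal (1 / p) * ereal (- p * ?K)
      \<le> ereal (1 / p) * Liminf (at_right 0) (\<lambda>t. ereal (1 / t) * elog (?act t / ?act 0))"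
    using p by (intro ereal_mult_left_mono) auto
  then have "- ereal ?K
      \<le> ereal (1 / p) * Liminf (at_right 0) (\<lambda>t. ereal (1 / t) * elog (?act t / ?act 0))"
    using p by simp
  then show ?thesis
    unfolding Theta_plus_def by (simp only: ereal_uminus_le_reorder)
qed

section \<open>Upper semicontinuity of \<open>\<vartheta>\<^sup>*\<close>\<close>

lemma theta_star_lessD:
  assumes "theta_star P x < c"
  obtains \<eta> where "\<eta> > 0"
    and "\<And>y z. dist y x < \<eta> \<Longrightarrow> dist z x < \<eta> \<Longrightarrow> y \<noteq> z \<Longrightarrow> theta_plus P y z < c"
proof -
  have "eventually (\<lambda>(y, z). theta_plus P y z < c) (at (x, x) within {(y, z). y \<noteq> z})"
    using Limsup_lessD[OF assms[unfolded theta_star_def]] by (simp add: case_prod_unfold)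
  then obtain e where e: "e > 0"
    "\<And>y z. y \<noteq> z \<Longrightarrow> (y, z) \<noteq> (x, x) \<Longrightarrow> dist (y, z) (x, x) < e \<Longrightarrow> theta_plus P y z < c"
    unfolding eventually_at by auto
  show thesis
  proof (rule that[of "e / 2"])
    fix y z assume *: "dist y x < e / 2" "dist z x < e / 2" "y \<noteq> z"
    have "dist (y, z) (x, x) \<le> dist y x + dist z x"
      by (simp add: dist_Pair_Pair sqrt_sum_squares_le_sum)
    then show "theta_plus P y z < c"
      using * e(2)[of y z] by auto
  qed (use e in simp)
qed

text \<open>A neighbourhood of \<open>(x, x)\<close> is also a neighbourhood of \<open>(y, y)\<close> for every \<open>y\<close> close to \<open>x\<close>, so a
  bound on \<open>\<vartheta>\<^sup>+\<close> there controls \<open>\<vartheta>\<^sup>*(y)\<close>. The intermediate value \<open>c'\<close> restores the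
  strict inequality, which is lost in the upper limit.\<close>

lemma theta_star_upper_semicontinuous:
  assumes "theta_star P x < c"
  obtains \<eta> where "\<eta> > 0" and "\<And>y. dist y x < \<eta> \<Longrightarrow> theta_star P y < c"
proof -
  obtain c' where c': "theta_star P x < c'" "c' < c"
    using dense[OF assms] by auto
  obtain \<eta> where \<eta>: "\<eta> > 0"
    "\<And>y z. dist y x < \<eta> \<Longrightarrow> dist z x < \<eta> \<Longrightarrow> y \<noteq> z \<Longrightarrow> theta_plus P y z < c'"
    using theta_star_lessD[OF c'(1)] by metis
  show thesis
  proof (rule that[OF \<eta>(1)])
    fix y assume "dist y x < \<eta>"
    then have "(y, y) \<in> ball x \<eta> \<times> ball x \<eta>"
      by (simp add: dist_commute)
    moreover have "open (ball x \<eta> \<times> ball x \<eta>)"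
      by (simp add: open_Times)
    ultimately have "eventually (\<lambda>w. w \<in> ball x \<eta> \<times> ball x \<eta>) (nhds (y, y))"
      by (simp add: eventually_nhds_in_open)
    then have "eventually (\<lambda>(u, v). theta_plus P u v \<le> c') (at (y, y) within {(u, v). u \<noteq> v})"
      unfolding eventually_at_filter
      by (rule eventually_mono) (auto simp: dist_commute intro!: less_imp_le[OF \<eta>(2)])
    then have "theta_star P y \<le> c'"
      unfolding theta_star_def by (intro Limsup_bounded) (simp add: case_prod_unfold)
    then show "theta_star P y < c"
      using c' by simp
  qed
qed

lemma borel_measurable_upper_semicontinuous_on:
  fixes f :: "'b::metric_space \<Rightarrow> 'c::{linorder_topology, second_countable_topology}"
  assumes S: "S \<in> sets M" "sets M = sets borel"
    and usc: "\<And>a c. a \<in> S \<Longrightarrow> f a < c \<Longrightarrow> \<exists>\<eta>>0. \<forall>b\<in>S. dist b a < \<eta> \<longrightarrow> f b < c"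
  shows "f \<in> borel_measurable (restrict_space M S)"
proof (rule borel_measurableI_less)
  fix c
  have "openin (top_of_set S) {a \<in> S. f a < c}"
    unfolding openin_contains_ball
  proof (intro conjI ballI)
    fix a assume "a \<in> {a \<in> S. f a < c}"
    then obtain \<eta> where "\<eta> > 0" "\<forall>b\<in>S. dist b a < \<eta> \<longrightarrow> f b < c"
      using usc[of a c] by auto
    then show "\<exists>\<eta>>0. ball a \<eta> \<inter> S \<subseteq> {a \<in> S. f a < c}"
      by (intro exI[of _ \<eta>]) (auto simp: dist_commute)
  qed auto
  then obtain U where "open U" "{a \<in> S. f a < c} = S \<inter> U"
    unfolding openin_open by auto
  then have "{a \<in> S. f a < c} \<in> sets M"
    using S by (simp add: sets.Int)
  moreover have "S \<inter> space M = S"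
    using S(1) sets.sets_into_space by blast
  ultimately show "{a \<in> space (restrict_space M S). f a < c} \<in> sets (restrict_space M S)"
    using S(1) by (simp add: space_restrict_space sets_restrict_space_iff)
qed

section \<open>Riemann sums of upper semicontinuous functions\<close>

text \<open>A finite subcover gives one bound for all the neighbourhoods that occur, and its Lebesgue number
  puts any two sufficiently close points into a common one of them.\<close>

lemma compact_locally_bounded_near_diagonal:
  fixes g :: "'b::metric_space \<Rightarrow> 'b \<Rightarrow> ereal"
  assumes S: "compact S"
    and loc: "\<And>a. a \<in> S \<Longrightarrow>
      \<exists>c::real. \<exists>\<eta>>0. \<forall>b\<in>S. \<forall>b'\<in>S. dist b a < \<eta> \<longrightarrow> dist b' a < \<eta> \<longrightarrow> g b b' < c"
  obtains M :: real and \<eta> where "\<eta> > 0"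
    and "\<And>b b'. b \<in> S \<Longrightarrow> b' \<in> S \<Longrightarrow> dist b b' < \<eta> \<Longrightarrow> g b b' \<le> M"
proof -
  obtain c \<eta> where c\<eta>: "\<And>a. a \<in> S \<Longrightarrow> \<eta> a > 0"
    "\<And>a b b'. a \<in> S \<Longrightarrow> b \<in> S \<Longrightarrow> b' \<in> S \<Longrightarrow> dist b a < \<eta> a \<Longrightarrow> dist b' a < \<eta> a
      \<Longrightarrow> g b b' < ereal (c a)"
    using loc by metis
  have "S \<subseteq> (\<Union>a\<in>S. ball a (\<eta> a))"
    using c\<eta>(1) by force
  then obtain C where C: "C \<subseteq> S" "finite C" "S \<subseteq> (\<Union>a\<in>C. ball a (\<eta> a))"
    using compactE_image[OF S, of S "\<lambda>a. ball a (\<eta> a)"] by auto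
  obtain e where e: "e > 0" "\<And>x. x \<in> S \<Longrightarrow> \<exists>G\<in>(\<lambda>a. ball a (\<eta> a)) ` C. ball x e \<subseteq> G"
    using Heine_Borel_lemma[OF S, of "(\<lambda>a. ball a (\<eta> a)) ` C"] C by auto
  show thesis
  proof (rule that[OF e(1)])
    fix b b' assume b: "b \<in> S" "b' \<in> S" "dist b b' < e"
    then obtain a where a: "a \<in> C" "ball b e \<subseteq> ball a (\<eta> a)"
      using e(2) by blast
    have "b \<in> ball b e" "b' \<in> ball b e"
      using b e(1) by auto
    then have "b \<in> ball a (\<eta> a)" "b' \<in> ball a (\<eta> a)"
      using a(2) by blast+
    then have "g b b' < ereal (c a)"
      using c\<eta>(2)[of a b b'] a C b by (auto simp: dist_commute)
    also have "c a \<le> Max (c ` C)"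
      using a C by simp
    finally show "g b b' \<le> Max (c ` C)"
      by simp
  qed
qed

text \<open>The pointwise identity \<open>(f + N)\<^sup>+ + min f\<^sup>- N = f\<^sup>+ + N\<close> turns the hypothesis into
  \<open>T + \<integral> min f\<^sup>- N \<le> \<integral> f\<^sup>+\<close>, where \<open>N\<close> can tend to \<open>\<infinity>\<close> by monotone convergence. The total mass
  1 is what makes the two constants \<open>N\<close> cancel.\<close>

lemma le_ereal_integral_of_shifts:
  fixes T :: ereal
  assumes [measurable]: "f \<in> borel_measurable M" and M: "emeasure M (space M) = 1"
    and fin: "(\<integral>\<^sup>+ x. e2ennreal (f x) \<partial>M) < \<infinity>"
    and le: "\<And>N::nat. T + N \<le> enn2ereal (\<integral>\<^sup>+ x. e2ennreal (f x + N) \<partial>M)"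
  shows "T \<le> ereal_integral M f"
proof -
  define A where "A = (\<integral>\<^sup>+ x. e2ennreal (f x) \<partial>M)"
  define B where "B N = (\<integral>\<^sup>+ x. inf (e2ennreal (- f x)) (of_nat N) \<partial>M)" for N
  have eq: "(\<integral>\<^sup>+ x. e2ennreal (f x + N) \<partial>M) + B N = A + of_nat N" for N :: nat
  proof -
    have "(\<integral>\<^sup>+ x. e2ennreal (f x + N) \<partial>M) + B N
        = (\<integral>\<^sup>+ x. e2ennreal (f x + N) + inf (e2ennreal (- f x)) (of_nat N) \<partial>M)"
      unfolding B_def by (rule nn_integral_add[symmetric]) measurable
    also have "\<dots> = (\<integral>\<^sup>+ x. e2ennreal (f x) + of_nat N \<partial>M)"
    proof (rule nn_integral_cong)
      fix x
      show "e2ennreal (f x + N) + inf (e2ennreal (- f x)) (of_nat N) = e2ennreal (f x) + of_nat N"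
      proof (cases "f x")
        case (real r)
        have "max 0 (r + N) + min (max 0 (- r)) N = max 0 r + N"
          by auto
        then have "ennreal (max 0 (r + N)) + ennreal (min (max 0 (- r)) N) = ennreal (max 0 r) + ennreal N"
          by (metis ennreal_plus max.cobounded1 min.boundedI of_nat_0_le_iff)
        moreover have "inf (ennreal (- r)) (of_nat N) = ennreal (min (max 0 (- r)) N)"
          by (subst min_ennreal[symmetric]) (auto simp: inf_min ennreal_of_nat_eq_real_of_nat)
        ultimately show ?thesis
          using real by (simp add: ennreal_of_nat_eq_real_of_nat)
      qed (auto simp: e2ennreal_neg inf_absorb2)
    qed
    also have "\<dots> = A + of_nat N"
      using M by (simp add: A_def nn_integral_add)
    finally show ?thesis .
  qed
  have "incseq (\<lambda>N x. inf (e2ennreal (- f x)) (of_nat N))"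
    by (auto simp: incseq_def le_fun_def intro!: le_infI2 of_nat_mono)
  then have "(\<integral>\<^sup>+ x. (SUP N. inf (e2ennreal (- f x)) (of_nat N)) \<partial>M) = (SUP N. B N)"
    unfolding B_def by (rule nn_integral_monotone_convergence_SUP) measurable
  then have supB: "(\<integral>\<^sup>+ x. e2ennreal (- f x) \<partial>M) = (SUP N. B N)"
    by (simp add: inf_SUP[symmetric] ennreal_SUP_of_nat_eq_top)
  obtain \<alpha> where \<alpha>: "A = ennreal \<alpha>" "\<alpha> \<ge> 0"
    using fin unfolding A_def[symmetric] by (cases A) auto
  show ?thesis
  proof (cases T)
    case (real r)
    have "B N \<le> ennreal (\<alpha> - r)" for N
    proof -
      have "(\<integral>\<^sup>+ x. e2ennreal (f x + N) \<partial>M) + B N = ennreal (\<alpha> + N)"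
        unfolding eq using \<alpha> by (simp add: ennreal_of_nat_eq_real_of_nat)
      moreover obtain i where i: "(\<integral>\<^sup>+ x. e2ennreal (f x + N) \<partial>M) = ennreal i" "i \<ge> 0"
        using calculation by (cases "\<integral>\<^sup>+ x. e2ennreal (f x + N) \<partial>M") auto
      moreover obtain b where b: "B N = ennreal b" "b \<ge> 0"
        using calculation(1) by (cases "B N") auto
      ultimately have "i + b = \<alpha> + N"
        using \<alpha> by (simp flip: ennreal_plus)
      moreover have "r + N \<le> i"
        using le[of N] i real by simp
      ultimately show ?thesis
        using b by (simp add: ennreal_leI)
    qed
    then have "(\<integral>\<^sup>+ x. e2ennreal (- f x) \<partial>M) \<le> ennreal (\<alpha> - r)"
      unfolding supB by (rule SUP_least)
    moreover have "r \<le> \<alpha>"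
      using le[of 0] real \<alpha> by (simp add: A_def[symmetric] zero_ereal_def[symmetric])
    ultimately obtain b where "(\<integral>\<^sup>+ x. e2ennreal (- f x) \<partial>M) = ennreal b" "b \<ge> 0" "b \<le> \<alpha> - r"
      by (cases "\<integral>\<^sup>+ x. e2ennreal (- f x) \<partial>M") (auto simp: top_unique)
    then show ?thesis
      using \<alpha> real by (simp add: ereal_integral_def A_def[symmetric])
  next
    case PInf
    then show ?thesis
      using le[of 0] \<alpha> by (simp add: A_def[symmetric] zero_ereal_def[symmetric])
  qed simp
qed

text \<open>The half-open grid intervals are disjoint, and \<open>\<lfloor>n * a\<rfloor>\<close> is the index of the one containing
  \<open>a\<close>. For \<open>a \<ge> 1\<close> there is none.\<close>

lemma step_function_value:
  fixes c :: "nat \<Rightarrow> ennreal"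
  assumes "n > 0" "0 \<le> a"
  shows "(\<Sum>i<n. c i * indicator {real i / n..<real (Suc i) / n} a)
    = (if nat \<lfloor>n * a\<rfloor> < n then c (nat \<lfloor>n * a\<rfloor>) else 0)"
proof -
  have "indicator {real i / n..<real (Suc i) / n} a = (if i = nat \<lfloor>n * a\<rfloor> then 1 else 0 :: ennreal)" for i
  proof -
    have "a \<in> {real i / n..<real (Suc i) / n} \<longleftrightarrow> real i \<le> n * a \<and> n * a < real i + 1"
      using assms by (auto simp: field_simps)
    also have "\<dots> \<longleftrightarrow> \<lfloor>n * a\<rfloor> = int i"
      by (simp add: floor_eq_iff)
    also have "\<dots> \<longleftrightarrow> i = nat \<lfloor>n * a\<rfloor>"
      using assms by auto
    finally show ?thesis by (simp add: indicator_def)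
  qed
  then have "(\<Sum>i<n. c i * indicator {real i / n..<real (Suc i) / n} a)
      = (\<Sum>i<n. if i = nat \<lfloor>n * a\<rfloor> then c i else 0)"
    by (intro sum.cong refl) (subst \<open>\<And>i. indicator _ a = _\<close>, simp)
  then show ?thesis
    by simp
qed

lemma nn_integral_step_function:
  fixes c :: "nat \<Rightarrow> ennreal"
  assumes "n > 0"
  shows "(\<integral>\<^sup>+ a. (\<Sum>i<n. c i * indicator {real i / n..<real (Suc i) / n} a)
      \<partial>restrict_space lborel {0..1}) = (\<Sum>i<n. c i * ennreal (1 / n))"
proof -
  have "(\<integral>\<^sup>+ a. c i * indicator {real i / n..<real (Suc i) / n} a \<partial>restrict_space lborel {0..1})
      = c i * ennreal (1 / n)" (is "?I i = _") if "i < n" for i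
  proof -
    have "real (Suc i) / n \<le> 1"
      using that by simp
    then have sub: "{real i / n..<real (Suc i) / n} \<subseteq> {0..1}"
      using divide_nonneg_nonneg[of "real i" "real n"] by (force simp del: divide_nonneg_nonneg)
    then have "{real i / n..<real (Suc i) / n} \<in> sets (restrict_space lborel {0..1})"
      by (simp add: sets_restrict_space_iff)
    moreover have "emeasure (restrict_space lborel {0..1}) {real i / n..<real (Suc i) / n} = ennreal (1 / n)"
      using sub assms by (simp add: emeasure_restrict_space divide_right_mono flip: diff_divide_distrib)
    ultimately show ?thesis
      by (simp add: nn_integral_cmult_indicator)
  qed
  then have "(\<Sum>i<n. ?I i) = (\<Sum>i<n. c i * ennreal (1 / n))"
    by (intro sum.cong refl) (simp only: lessThan_iff)
  moreover have "(\<lambda>a. c i * indicator {real i / n..<real (Suc i) / n} a)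
      \<in> borel_measurable (restrict_space lborel {0..1})" for i
    by (intro measurable_restrict_space1) measurable
  ultimately show ?thesis
    by (subst nn_integral_sum) (simp_all only:)
qed

text \<open>Reverse Fatou for functions that may tend to \<open>-\<infinity>\<close>: shifting by \<open>N\<close> and taking positive parts
  gives nonnegative step functions \<open>u n\<close> with a common upper bound, to which the lemma for
  nonnegative functions applies. Here \<open>\<theta>\<close> is an interval function that is locally controlled by \<open>f\<close>,
  and \<open>T\<close> lies below all Riemann sums with real values strictly above those of \<open>\<theta>\<close>.\<close>

lemma le_ereal_integral_of_Riemann_sums:
  fixes \<theta> :: "real \<Rightarrow> real \<Rightarrow> ereal" and f :: "real \<Rightarrow> ereal" and T :: ereal
  assumes near: "\<And>a c. a \<in> {0..1} \<Longrightarrow> f a < c \<Longrightarrow> \<exists>\<eta>>0. \<forall>b\<in>{0..1}. \<forall>b'\<in>{0..1}.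
      dist b a < \<eta> \<longrightarrow> dist b' a < \<eta> \<longrightarrow> b < b' \<longrightarrow> \<theta> b b' < c"
    and usc: "\<And>a c. a \<in> {0..1} \<Longrightarrow> f a < c \<Longrightarrow> \<exists>\<eta>>0. \<forall>b\<in>{0..1}. dist b a < \<eta> \<longrightarrow> f b < c"
    and fin: "\<And>a. a \<in> {0..1} \<Longrightarrow> f a < \<infinity>"
    and T: "\<And>n a k. partition01 n a \<Longrightarrow> (\<And>i. i < n \<Longrightarrow> \<theta> (a i) (a (Suc i)) < ereal (k i))
      \<Longrightarrow> T \<le> ereal (\<Sum>i<n. (a (Suc i) - a i) * k i)"
  shows "T \<le> ereal_integral (restrict_space lborel {0..1}) f"
proof -
  let ?L = "restrict_space lborel {0..1::real}"
  have meas[measurable]: "f \<in> borel_measurable ?L"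
    by (rule borel_measurable_upper_semicontinuous_on[OF _ _ usc]) auto
  have one: "emeasure ?L (space ?L) = 1"
    by (simp add: emeasure_restrict_space space_restrict_space)
  \<comment> \<open>A single function of two points, so that one compactness argument bounds both \<open>f\<close> and \<open>\<theta>\<close>. For
    \<open>b \<ge> b'\<close>, where \<open>\<theta> b b'\<close> is not controlled, its value is replaced by \<open>f b\<close>.\<close>
  obtain M \<eta> where \<eta>: "\<eta> > 0"
    and "\<And>b b'. b \<in> {0..1} \<Longrightarrow> b' \<in> {0..1} \<Longrightarrow> dist b b' < \<eta>
      \<Longrightarrow> max (f b) (if b < b' then \<theta> b b' else f b) \<le> ereal M"
  proof (rule compact_locally_bounded_near_diagonal[of "{0..1}"
        "\<lambda>b b'. max (f b) (if b < b' then \<theta> b b' else f b)"])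
    fix a :: real assume a: "a \<in> {0..1}"
    obtain c where c: "f a < ereal c"
      using ereal_dense2[OF fin[OF a]] by auto
    obtain e1 e2 where "e1 > 0" "\<forall>b\<in>{0..1}. dist b a < e1 \<longrightarrow> f b < c" "e2 > 0"
      "\<forall>b\<in>{0..1}. \<forall>b'\<in>{0..1}. dist b a < e2 \<longrightarrow> dist b' a < e2 \<longrightarrow> b < b' \<longrightarrow> \<theta> b b' < c"
      using usc[OF a c] near[OF a c] by metis
    then show "\<exists>c::real. \<exists>\<eta>>0. \<forall>b\<in>{0..1}. \<forall>b'\<in>{0..1}. dist b a < \<eta> \<longrightarrow> dist b' a < \<eta>
        \<longrightarrow> max (f b) (if b < b' then \<theta> b b' else f b) < c"
      by (intro exI[of _ c] exI[of _ "min e1 e2"]) simp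
  qed auto
  then have fM: "\<And>b. b \<in> {0..1} \<Longrightarrow> f b \<le> M"
    and \<theta>M: "\<And>b b'. b \<in> {0..1} \<Longrightarrow> b' \<in> {0..1} \<Longrightarrow> dist b b' < \<eta> \<Longrightarrow> b < b' \<Longrightarrow> \<theta> b b' \<le> M"
    by (metis dist_self max.bounded_iff)+
  obtain n0 where n0: "n0 > 0" "1 / real n0 < \<eta>"
    using \<eta> by (metis nat_approx_posE zero_less_Suc)
  have "(\<integral>\<^sup>+ a. e2ennreal (f a) \<partial>?L) \<le> (\<integral>\<^sup>+ a. ennreal M \<partial>?L)"
    using fM e2ennreal_mono by (intro nn_integral_mono) (fastforce simp: space_restrict_space)
  then have finf: "(\<integral>\<^sup>+ a. e2ennreal (f a) \<partial>?L) < \<infinity>"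
    using one by (simp add: order_le_less_trans)
  have "T + N \<le> enn2ereal (\<integral>\<^sup>+ a. e2ennreal (f a + N) \<partial>?L)" for N :: nat
  proof -
    define q where "q n i = e2ennreal (\<theta> (real i / n) (real (Suc i) / n) + N)" for n i :: nat
    define u where "u n a = (\<Sum>i<n. q n i * indicator {real i / n..<real (Suc i) / n} a)" for n and a :: real
    have u_meas: "u n \<in> borel_measurable ?L" for n
      unfolding u_def by (intro measurable_restrict_space1) measurable
    have grid: "real i / n \<in> {0..1}" "real (Suc i) / n \<in> {0..1}" "real i / n < real (Suc i) / n"
      "dist (real i / n) (real (Suc i) / n) = 1 / n" if "i < n" for i n :: nat
      using that by (auto simp: dist_real_def divide_simps)
    have close: "1 / real n < e" if "n \<ge> k" "k > 0" "1 / real k < e" for k n e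
      using that by (meson frac_le le_less_trans of_nat_0_less_iff of_nat_mono order_refl zero_le_one)
    have qM: "q n i \<le> ennreal (M + N)" if "n \<ge> n0" "i < n" for n i
    proof -
      have "\<theta> (real i / n) (real (Suc i) / n) \<le> M"
        using grid[OF that(2)] close[OF that(1) n0] by (intro \<theta>M) auto
      then show ?thesis
        unfolding q_def by (metis add_right_mono e2ennreal_ereal e2ennreal_mono plus_ereal.simps(1))
    qed
    have TN: "T + N \<le> enn2ereal (\<integral>\<^sup>+ a. u n a \<partial>?L)" if n: "n \<ge> n0" for n
    proof -
      define x where "x i = enn2real (q n i)" for i
      have npos: "n > 0" using n n0 by simp
      have x: "q n i = ennreal (x i)" if "i < n" for i
        using qM[OF n that] unfolding x_def
        by (metis ennreal_enn2real ennreal_less_top order_le_less_trans)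
      have x0: "x i \<ge> 0" for i by (simp add: x_def)
      have "(\<integral>\<^sup>+ a. u n a \<partial>?L) = (\<Sum>i<n. q n i * ennreal (1 / n))"
        unfolding u_def by (rule nn_integral_step_function[OF npos])
      also have "\<dots> = (\<Sum>i<n. ennreal (x i / n))"
        using x x0 by (intro sum.cong) (auto simp flip: ennreal_mult)
      also have "\<dots> = ennreal (\<Sum>i<n. x i / n)"
        using x0 by (intro sum_ennreal) simp
      finally have int: "(\<integral>\<^sup>+ a. u n a \<partial>?L) = ennreal (\<Sum>i<n. x i / n)" .
      \<comment> \<open>\<open>x i - N\<close> is \<open>max \<theta>\<^sub>i (- N)\<close>, a real upper bound of the \<open>i\<close>-th value \<open>\<theta>\<^sub>i\<close> of \<open>\<theta>\<close>. Adding
        \<open>\<delta>\<close> makes it strict.\<close>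
      have "T + N \<le> ereal (\<Sum>i<n. x i / n) + ereal \<delta>" if "\<delta> > 0" for \<delta>
      proof -
        have part: "partition01 n (\<lambda>i. real i / n)"
          using npos by (auto simp: partition01_def divide_strict_right_mono)
        have "\<theta> (real i / n) (real (Suc i) / n) < ereal (x i - N + \<delta>)" if "i < n" for i
        proof (cases "\<theta> (real i / n) (real (Suc i) / n)")
          case (real r)
          then have "ennreal (r + N) \<le> ennreal (x i)"
            using x[OF that] unfolding q_def by simp
          then have "r + N \<le> x i"
            using x0[of i] by simp
          then show ?thesis
            using real \<open>\<delta> > 0\<close> by simp
        next
          case PInf
          then show ?thesis
            using x[OF that] unfolding q_def by simp
        qed simp
        from T[OF part this]
        have "T \<le> ereal (\<Sum>i<n. (real (Suc i) / n - real i / n) * (x i - N + \<delta>))"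
          by simp
        also have "(\<Sum>i<n. (real (Suc i) / n - real i / n) * (x i - N + \<delta>))
            = (\<Sum>i<n. x i / n + (\<delta> - N) / n)"
          using npos by (intro sum.cong) (auto simp: field_simps)
        also have "\<dots> = (\<Sum>i<n. x i / n) - N + \<delta>"
          using npos by (simp add: sum.distrib)
        finally show ?thesis
          by (cases T) auto
      qed
      then have "T + N \<le> ereal (\<Sum>i<n. x i / n)"
        by (rule ereal_le_epsilon2)
      moreover have "0 \<le> (\<Sum>i<n. x i / n)"
        using x0 by (intro sum_nonneg) simp
      ultimately show ?thesis
        by (simp only: int enn2ereal_ennreal)
    qed
    have u_val: "u n a = 0 \<or> (\<exists>i<n. u n a = q n i \<and> dist (real i / n) a \<le> 1 / n \<and> dist (real (Suc i) / n) a \<le> 1 / n)"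
      if "a \<in> {0..1}" "n > 0" for n a
    proof -
      let ?i = "nat \<lfloor>n * a\<rfloor>"
      have "real ?i \<le> n * a" "n * a < real ?i + 1"
        using that by (auto simp: of_nat_nat)
      then have "real ?i / n \<le> a" "a \<le> (real ?i + 1) / n"
        using that(2) by (simp_all add: pos_divide_le_eq pos_le_divide_eq mult.commute)
      then have "dist (real ?i / n) a \<le> 1 / n" "dist (real (Suc ?i) / n) a \<le> 1 / n"
        by (simp_all add: dist_real_def abs_le_iff add_divide_distrib)
      moreover have "u n a = (if ?i < n then q n ?i else 0)"
        unfolding u_def using that by (intro step_function_value) auto
      ultimately show ?thesis
        by (cases "?i < n") auto
    qed
    have lim: "limsup (\<lambda>j. u (j + n0) a) \<le> e2ennreal (f a + N)" if a: "a \<in> {0..1}" for a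
    proof -
      have *: "limsup (\<lambda>j. u (j + n0) a) \<le> e2ennreal (c + N)" if c: "f a < c" for c
      proof -
        obtain e where e: "e > 0" "\<And>b b'. b \<in> {0..1} \<Longrightarrow> b' \<in> {0..1} \<Longrightarrow>
            dist b a < e \<Longrightarrow> dist b' a < e \<Longrightarrow> b < b' \<Longrightarrow> \<theta> b b' < c"
          using near[OF a c] by metis
        obtain k where k: "k > 0" "1 / real k < e"
          using e(1) by (metis nat_approx_posE zero_less_Suc)
        have "u (j + n0) a \<le> e2ennreal (c + N)" if j: "j \<ge> k" for j
        proof -
          have small: "1 / real (j + n0) < e"
            using close[of k "j + n0" e] j k by simp
          consider "u (j + n0) a = 0" | i where "i < j + n0" "u (j + n0) a = q (j + n0) i"
            "dist (real i / (j + n0)) a < e" "dist (real (Suc i) / (j + n0)) a < e"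
            using u_val[OF a, of "j + n0"] n0(1) small by fastforce
          then show ?thesis
          proof cases
            case 2
            then have "\<theta> (real i / (j + n0)) (real (Suc i) / (j + n0)) < c"
              using grid[of i "j + n0"] by (intro e(2)) auto
            then show ?thesis
              unfolding 2 q_def by (intro e2ennreal_mono add_right_mono) (simp add: less_imp_le)
          qed simp
        qed
        then show ?thesis
          by (intro Limsup_bounded) (auto simp: eventually_sequentially)
      qed
      show ?thesis
      proof (cases "limsup (\<lambda>j. u (j + n0) a) = 0")
        case False
        define l where "l = enn2ereal (limsup (\<lambda>j. u (j + n0) a))"
        have l: "l > 0"
          using False unfolding l_def by (metis e2ennreal_enn2ereal e2ennreal_neg not_less)
        \<comment> \<open>The positive part is inactive where the upper limit is positive, so the bounds \<open>c\<close> can be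
          lowered to \<open>f a\<close> by density.\<close>
        have "l - N \<le> f a"
        proof (rule dense_ge)
          fix c assume "f a < c"
          then have "l \<le> enn2ereal (e2ennreal (c + N))"
            using * unfolding l_def by (simp add: less_eq_ennreal.rep_eq)
          then have "l \<le> c + N"
            using l by (metis e2ennreal_neg enn2ereal_e2ennreal leD le_cases zero_ennreal.rep_eq)
          then show "l - N \<le> c"
            by (simp add: ereal_minus_le)
        qed
        then have "l \<le> f a + N"
          by (simp add: ereal_minus_le)
        then have "e2ennreal l \<le> e2ennreal (f a + N)"
          by (rule e2ennreal_mono)
        then show ?thesis by (simp add: l_def)
      qed simp
    qed
    have "e2ennreal (T + N) \<le> limsup (\<lambda>j. \<integral>\<^sup>+ a. u (j + n0) a \<partial>?L)"
    proof (rule le_Limsup)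
      show "\<forall>\<^sub>F j in sequentially. e2ennreal (T + N) \<le> (\<integral>\<^sup>+ a. u (j + n0) a \<partial>?L)"
        using e2ennreal_mono[OF TN] by (simp add: always_eventually)
    qed simp
    also have "\<dots> \<le> (\<integral>\<^sup>+ a. limsup (\<lambda>j. u (j + n0) a) \<partial>?L)"
    proof (rule nn_integral_limsup)
      fix j
      have "u (j + n0) a \<le> ennreal (M + N)" if "a \<in> {0..1}" for a
        using u_val[OF that, of "j + n0"] qM[of "j + n0"] n0(1) by fastforce
      then show "AE a in ?L. u (j + n0) a \<le> ennreal (M + N)"
        by (intro AE_I2) (simp add: space_restrict_space)
    qed (use u_meas one in auto)
    also have "\<dots> \<le> (\<integral>\<^sup>+ a. e2ennreal (f a + N) \<partial>?L)"
      using lim by (intro nn_integral_mono) (simp add: space_restrict_space)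
    finally have "enn2ereal (e2ennreal (T + N)) \<le> enn2ereal (\<integral>\<^sup>+ a. e2ennreal (f a + N) \<partial>?L)"
      by (simp add: less_eq_ennreal.rep_eq)
    moreover have "T + N \<le> enn2ereal (e2ennreal (T + N))"
      by (metis enn2ereal_e2ennreal enn2ereal_nonneg le_cases order_trans order_refl)
    ultimately show ?thesis
      by (rule order_trans[rotated])
  qed
  then show ?thesis
    by (rule le_ereal_integral_of_shifts[OF meas one finf])
qed

section \<open>Comparison of \<open>\<Theta>\<^sup>+\<close> with the integral of \<open>\<vartheta>\<^sup>*\<close>\<close>

theorem proposition1p2:
  fixes m :: "'a::polish_space measure"
    and P :: "real \<Rightarrow> 'a measure \<Rightarrow> 'a measure"
    and \<gamma> :: "real \<Rightarrow> 'a"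
    and p :: real
  assumes "metric_measure_space m"
    and "dual_heat_semigroup m P"
    and "geodesic \<gamma>" and "\<gamma> 0 \<noteq> \<gamma> 1"
    and "1 \<le> p"
    and "\<forall>a\<in>{0..1}. theta_star P (\<gamma> a) < \<infinity>"
  shows "Theta_plus p P \<gamma>
    \<le> ereal_integral (restrict_space lborel {0..1}) (\<lambda>a. theta_star P (\<gamma> a))"
proof (rule le_ereal_integral_of_Riemann_sums[where \<theta> = "\<lambda>b b'. theta_plus P (\<gamma> b) (\<gamma> b')"])
  let ?D = "dist (\<gamma> 0) (\<gamma> 1)"
  have D: "?D > 0"
    using assms(4) by simp
  have geo: "dist (\<gamma> b) (\<gamma> a) = dist b a * ?D" if "a \<in> {0..1}" "b \<in> {0..1}" for a b
    using geodesic_dist[OF assms(3) that(2,1)] by (simp add: dist_real_def)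
  have close: "dist (\<gamma> b) (\<gamma> a) < e" if "a \<in> {0..1}" "b \<in> {0..1}" "dist b a < e / ?D" for a b e
    using geo[OF that(1,2)] that(3) D by (simp add: pos_less_divide_eq)
  show "\<exists>\<eta>>0. \<forall>b\<in>{0..1}. \<forall>b'\<in>{0..1}. dist b a < \<eta> \<longrightarrow> dist b' a < \<eta> \<longrightarrow> b < b'
      \<longrightarrow> theta_plus P (\<gamma> b) (\<gamma> b') < c"
    if a: "a \<in> {0..1}" and c: "theta_star P (\<gamma> a) < c" for a c
  proof -
    obtain e where e: "e > 0" "\<And>y z. dist y (\<gamma> a) < e \<Longrightarrow> dist z (\<gamma> a) < e \<Longrightarrow> y \<noteq> z
        \<Longrightarrow> theta_plus P y z < c"
      using theta_star_lessD[OF c] by metis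
    have "\<gamma> b \<noteq> \<gamma> b'" if "b \<in> {0..1}" "b' \<in> {0..1}" "b < b'" for b b'
      using geo[of b' b] that D by auto
    then show ?thesis
      using e(1) D a by (intro exI[of _ "e / ?D"]) (auto intro!: e(2) close simp del: atLeastAtMost_iff)
  qed
  show "\<exists>\<eta>>0. \<forall>b\<in>{0..1}. dist b a < \<eta> \<longrightarrow> theta_star P (\<gamma> b) < c"
    if a: "a \<in> {0..1}" and c: "theta_star P (\<gamma> a) < c" for a c
  proof -
    obtain e where e: "e > 0" "\<And>y. dist y (\<gamma> a) < e \<Longrightarrow> theta_star P y < c"
      using theta_star_upper_semicontinuous[OF c] by metis
    then show ?thesis
      using D a by (intro exI[of _ "e / ?D"]) (auto intro!: e(2) close simp del: atLeastAtMost_iff)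
  qed
  show "theta_star P (\<gamma> a) < \<infinity>" if "a \<in> {0..1}" for a
    using assms(6) that by blast
  show "Theta_plus p P \<gamma> \<le> ereal (\<Sum>i<n. (a (Suc i) - a i) * k i)"
    if "partition01 n a" "\<And>i. i < n \<Longrightarrow> theta_plus P (\<gamma> (a i)) (\<gamma> (a (Suc i))) < ereal (k i)" for n a k
    using Theta_plus_le_Riemann_sum[OF assms(3,4) _ that] assms(5) by simp
qed

end
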